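(* Let $\phi$ be a flow of a compact metric space $X$. (1) If $\Omega(\phi)\setminus Sing(\phi)$ is closed, then $h^*(\phi)=h(\phi)$. (2) If $\phi$ is singular-equicontinuous, then $h^*(\phi)=0$.
   Context: A flow is a continuous $\phi:\mathbb{R}\times X\to X$ with $\phi_0=\mathrm{id}$, $\phi_{t+s}=\phi_t\circ\phi_s$; $Sing(\phi)$ is the set of fixed points; $dist(z,A)=\inf_{a\in A}d(z,a)$. $x$ is nonwandering if $U\cap\bigcup_{t\ge T}\phi_t(U)\ne\emptyset$ for every $T>0$ and every neighborhood $U$ of $x$; $\Omega(\phi)$ is the set of nonwandering points. For compact $K\subset X$, $t>0$, $\epsilon>0$, let $r(t,\epsilon)$ be the minimal cardinality of $F\subset K$ with $K\subset\bigcup_{x\in F}\{y\in X: d(\phi_s(x),\phi_s(y))\le\epsilon\ \forall 0\le s\le t\}$, and $h(\phi,K)=\lim_{\epsilon\to0}\limsup_{t\to\infty}\frac1t\ln r(t,\epsilon)$; $h(\phi)=h(\phi,X)$ and $h^*(\phi)=\sup\{h(\phi,K): K\subset X\setminus Sing(\phi)\text{ compact}\}$. $\phi$ is singular-equicontinuous if for every $\epsilon>0$ there is $\delta>0$ such that $x,y\in X$ and $d(x,y)\le\delta\,dist(x,Sing(\phi))$ imply $d(\phi_t(x),\phi_t(y))\le\epsilon$ for all $t\in\mathbb{R}$. *)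

theory Defs
  imports "HOL-Analysis.Analysis"
begin

definition is_flow :: "(real \<Rightarrow> 'a::metric_space \<Rightarrow> 'a) \<Rightarrow> bool" where
  "is_flow \<phi> \<longleftrightarrow> continuous_on UNIV (\<lambda>p. \<phi> (fst p) (snd p)) \<and>
     \<phi> 0 = id \<and> (\<forall>t s. \<phi> (t + s) = \<phi> t \<circ> \<phi> s)"

definition Sing :: "(real \<Rightarrow> 'a \<Rightarrow> 'a) \<Rightarrow> 'a set" where
  "Sing \<phi> = {x. \<forall>t. \<phi> t x = x}"

definition dist_set :: "'a::metric_space \<Rightarrow> 'a set \<Rightarrow> ereal" where
  "dist_set z A = (if A = {} then \<infinity> else ereal (infdist z A))"

definition nonwandering :: "(real \<Rightarrow> 'a::topological_space \<Rightarrow> 'a) \<Rightarrow> 'a set" where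
  "nonwandering \<phi> = {x. \<forall>U T. open U \<and> x \<in> U \<and> T > 0 \<longrightarrow>
      U \<inter> (\<Union>t\<in>{T..}. \<phi> t ` U) \<noteq> {}}"

definition dyn_ball :: "(real \<Rightarrow> 'a::metric_space \<Rightarrow> 'a) \<Rightarrow> real \<Rightarrow> real \<Rightarrow> 'a \<Rightarrow> 'a set" where
  "dyn_ball \<phi> t \<epsilon> x = {y. \<forall>s\<in>{0..t}. dist (\<phi> s x) (\<phi> s y) \<le> \<epsilon>}"

definition span_num :: "(real \<Rightarrow> 'a::metric_space \<Rightarrow> 'a) \<Rightarrow> 'a set \<Rightarrow> real \<Rightarrow> real \<Rightarrow> nat" where
  "span_num \<phi> K t \<epsilon> = (LEAST n. \<exists>F. F \<subseteq> K \<and> finite F \<and> card F = n \<and>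
      K \<subseteq> (\<Union>x\<in>F. dyn_ball \<phi> t \<epsilon> x))"

definition entropy_on :: "(real \<Rightarrow> 'a::metric_space \<Rightarrow> 'a) \<Rightarrow> 'a set \<Rightarrow> ereal" where
  "entropy_on \<phi> K = Lim (at_right 0)
     (\<lambda>\<epsilon>. Limsup at_top (\<lambda>t. ereal (ln (real (span_num \<phi> K t \<epsilon>)) / t)))"

definition entropy :: "(real \<Rightarrow> 'a::metric_space \<Rightarrow> 'a) \<Rightarrow> ereal" where
  "entropy \<phi> = entropy_on \<phi> UNIV"

definition entropy_star :: "(real \<Rightarrow> 'a::metric_space \<Rightarrow> 'a) \<Rightarrow> ereal" where
  "entropy_star \<phi> = (SUP K\<in>{K. compact K \<and> K \<subseteq> - Sing \<phi>}. entropy_on \<phi> K)"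

definition singular_equicontinuous :: "(real \<Rightarrow> 'a::metric_space \<Rightarrow> 'a) \<Rightarrow> bool" where
  "singular_equicontinuous \<phi> \<longleftrightarrow> (\<forall>\<epsilon>>0. \<exists>\<delta>>0. \<forall>x y.
      ereal (dist x y) \<le> ereal \<delta> * dist_set x (Sing \<phi>) \<longrightarrow>
      (\<forall>t. dist (\<phi> t x) (\<phi> t y) \<le> \<epsilon>))"

end

theory Submission
  imports Defs "HOL-Real_Asymp.Real_Asymp"
begin

text \<open>The entropy of the flow is carried by its nonwandering set (Bowen): cut orbits into pieces
  of length \<open>\<tau>\<close>; pieces starting near the nonwandering set are coded by a minimal spanning set
  of it, the others by finitely many wandering open sets, each visited boundedly often, so the
  latter contribute only a polynomial factor. Singularities are fixed, hence contribute no
  entropy; if the nonsingular nonwandering points form a closed set, it is a compact set away from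
  the singularities that carries the whole entropy. Singular equicontinuity makes the flow
  equicontinuous on every compact set away from the singularities, which forces zero growth there.\<close>

section \<open>Spanning sets and growth at a fixed scale\<close>

text \<open>In contrast to \<open>span_num\<close>, the centres may lie outside \<open>K\<close>;
  unions and subsets of \<open>K\<close> can then be handled without moving centres.\<close>

definition spans :: "(real \<Rightarrow> 'a::metric_space \<Rightarrow> 'a) \<Rightarrow> 'a set \<Rightarrow> real \<Rightarrow> real \<Rightarrow> 'a set \<Rightarrow> bool" where
  "spans \<phi> K t \<epsilon> F \<longleftrightarrow> finite F \<and> K \<subseteq> (\<Union>x\<in>F. dyn_ball \<phi> t \<epsilon> x)"

text \<open>This is the function of \<epsilon> under the limit in \<open>entropy_on\<close>.\<close>

definition growth :: "(real \<Rightarrow> 'a::metric_space \<Rightarrow> 'a) \<Rightarrow> 'a set \<Rightarrow> real \<Rightarrow> ereal" where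
  "growth \<phi> K \<epsilon> = Limsup at_top (\<lambda>t. ereal (ln (real (span_num \<phi> K t \<epsilon>)) / t))"

text \<open>The value \<open>ln 0 = 0\<close> covers the case \<open>m = 0\<close>, which occurs
  when the set to be spanned is empty.\<close>

lemma ln_of_nat_mono:
  assumes "m \<le> n"
  shows "ln (real m) \<le> ln (real n)"
  using assms by (cases "m = 0"; cases "n = 0") auto

lemma span_num_le_card:
  assumes "spans \<phi> K t \<epsilon> F" "F \<subseteq> K"
  shows "span_num \<phi> K t \<epsilon> \<le> card F"
  unfolding span_num_def using assms by (intro Least_le) (auto simp: spans_def)

text \<open>One representative in \<open>K\<close> for each code that occurs gives a spanning set,
  so counting codes bounds the spanning number.\<close>

lemma span_num_le_card_code:
  assumes "finite S" "c ` K \<subseteq> S"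
    and close: "\<And>x y. x \<in> K \<Longrightarrow> y \<in> K \<Longrightarrow> c x = c y \<Longrightarrow> y \<in> dyn_ball \<phi> t \<epsilon> x"
  shows "span_num \<phi> K t \<epsilon> \<le> card S"
proof -
  let ?F = "inv_into K c ` c ` K"
  have fin: "finite (c ` K)"
    using assms finite_subset by blast
  have "y \<in> dyn_ball \<phi> t \<epsilon> (inv_into K c (c y))" if "y \<in> K" for y
    using that by (intro close) (auto intro: inv_into_into f_inv_into_f)
  then have "spans \<phi> K t \<epsilon> ?F"
    using fin unfolding spans_def by blast
  moreover have "?F \<subseteq> K"
    by (auto intro: inv_into_into)
  ultimately have "span_num \<phi> K t \<epsilon> \<le> card ?F"
    by (rule span_num_le_card)
  also have "\<dots> \<le> card (c ` K)"
    using fin by (rule card_image_le)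
  also have "\<dots> \<le> card S"
    using assms by (intro card_mono)
  finally show ?thesis .
qed

lemma dyn_ball_common_center:
  assumes "y \<in> dyn_ball \<phi> t \<epsilon> x" "z \<in> dyn_ball \<phi> t \<epsilon> x"
  shows "z \<in> dyn_ball \<phi> t (2 * \<epsilon>) y"
proof -
  have "dist (\<phi> s y) (\<phi> s z) \<le> 2 * \<epsilon>" if "s \<in> {0..t}" for s
  proof -
    have "dist (\<phi> s x) (\<phi> s y) \<le> \<epsilon>" "dist (\<phi> s x) (\<phi> s z) \<le> \<epsilon>"
      using assms that by (auto simp: dyn_ball_def)
    then show ?thesis
      using dist_triangle3[of "\<phi> s y" "\<phi> s z" "\<phi> s x"] by linarith
  qed
  then show ?thesis by (simp add: dyn_ball_def)
qed

text \<open>Code each point of \<open>K\<close> by a centre near it: points with a common centre are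
  within twice the radius. The factor 2 is the price for centres inside \<open>K\<close>.\<close>

lemma span_num_le_card_external:
  assumes "spans \<phi> K t \<epsilon> F"
  shows "span_num \<phi> K t (2 * \<epsilon>) \<le> card F"
proof -
  have "\<exists>x\<in>F. y \<in> dyn_ball \<phi> t \<epsilon> x" if "y \<in> K" for y
    using assms that by (auto simp: spans_def)
  then obtain c where "\<And>y. y \<in> K \<Longrightarrow> c y \<in> F \<and> y \<in> dyn_ball \<phi> t \<epsilon> (c y)"
    by metis
  then show ?thesis
    using assms by (intro span_num_le_card_code[where c = c])
      (auto simp: spans_def, metis dyn_ball_common_center)
qed

lemma flow_uniformly_continuous:
  fixes \<phi> :: "real \<Rightarrow> 'a::metric_space \<Rightarrow> 'a"
  assumes "compact (UNIV :: 'a set)" "is_flow \<phi>" "\<epsilon> > 0"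
  obtains \<delta> where "\<delta> > 0" "\<And>x y. dist x y < \<delta> \<Longrightarrow> y \<in> dyn_ball \<phi> t \<epsilon> x"
proof -
  have "continuous_on ({0..t} \<times> UNIV) (\<lambda>p. \<phi> (fst p) (snd p))"
    using assms(2) continuous_on_subset unfolding is_flow_def by blast
  then have "uniformly_continuous_on ({0..t} \<times> UNIV) (\<lambda>p. \<phi> (fst p) (snd p))"
    using assms(1) by (intro compact_uniformly_continuous compact_Times) auto
  then obtain \<delta> where \<delta>: "\<delta> > 0"
    "\<And>p q. p \<in> {0..t} \<times> UNIV \<Longrightarrow> q \<in> {0..t} \<times> UNIV \<Longrightarrow> dist q p < \<delta> \<Longrightarrow>
      dist (\<phi> (fst q) (snd q)) (\<phi> (fst p) (snd p)) < \<epsilon>"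
    using assms(3) unfolding uniformly_continuous_on_def by metis
  have "dist (\<phi> s x) (\<phi> s y) \<le> \<epsilon>" if "dist x y < \<delta>" "s \<in> {0..t}" for x y s
    using \<delta>(2)[of "(s, y)" "(s, x)"] that by (simp add: dist_Pair_Pair)
  then show thesis
    using \<delta>(1) by (intro that[of \<delta>]) (auto simp: dyn_ball_def)
qed

text \<open>By compactness some finite spanning set inside \<open>K\<close> exists, so the
  \<open>LEAST\<close> in \<open>span_num\<close> is attained.\<close>

lemma ex_minimal_spanning_set:
  fixes \<phi> :: "real \<Rightarrow> 'a::metric_space \<Rightarrow> 'a"
  assumes "compact (UNIV :: 'a set)" "is_flow \<phi>" "\<epsilon> > 0" "compact K"
  obtains F where "spans \<phi> K t \<epsilon> F" "F \<subseteq> K" "card F = span_num \<phi> K t \<epsilon>"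
proof -
  obtain \<delta> where \<delta>: "\<delta> > 0" "\<And>x y. dist x y < \<delta> \<Longrightarrow> y \<in> dyn_ball \<phi> t \<epsilon> x"
    using flow_uniformly_continuous[OF assms(1-3)] by metis
  obtain F where F: "finite F" "F \<subseteq> K" "K \<subseteq> (\<Union>x\<in>F. ball x \<delta>)"
    using compactE_image[OF \<open>compact K\<close>, of K "\<lambda>x. ball x \<delta>"] \<delta>(1) by force
  then have "\<exists>F. F \<subseteq> K \<and> finite F \<and> card F = card F \<and> K \<subseteq> (\<Union>x\<in>F. dyn_ball \<phi> t \<epsilon> x)"
    using \<delta>(2) by (intro exI[of _ F]) (auto, fastforce)
  then have "\<exists>n F. F \<subseteq> K \<and> finite F \<and> card F = n \<and> K \<subseteq> (\<Union>x\<in>F. dyn_ball \<phi> t \<epsilon> x)"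
    by metis
  from LeastI_ex[OF this] show thesis
    using that unfolding span_num_def spans_def by metis
qed

lemma dyn_ball_mono:
  assumes "t' \<le> t" "\<epsilon> \<le> \<epsilon>'"
  shows "dyn_ball \<phi> t \<epsilon> x \<subseteq> dyn_ball \<phi> t' \<epsilon>' x"
  using assms unfolding dyn_ball_def by (auto intro: order_trans)

lemma growth_antimono:
  fixes \<phi> :: "real \<Rightarrow> 'a::metric_space \<Rightarrow> 'a"
  assumes "compact (UNIV :: 'a set)" "is_flow \<phi>" "compact K" "0 < \<epsilon>" "\<epsilon> \<le> \<epsilon>'"
  shows "growth \<phi> K \<epsilon>' \<le> growth \<phi> K \<epsilon>"
proof -
  have "span_num \<phi> K t \<epsilon>' \<le> span_num \<phi> K t \<epsilon>" for t
  proof -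
    obtain F where F: "spans \<phi> K t \<epsilon> F" "F \<subseteq> K" "card F = span_num \<phi> K t \<epsilon>"
      using ex_minimal_spanning_set[OF assms(1,2,4,3)] by metis
    have "spans \<phi> K t \<epsilon>' F"
      using F(1) dyn_ball_mono[OF order_refl assms(5)] unfolding spans_def by blast
    then show ?thesis
      using span_num_le_card F by metis
  qed
  then show ?thesis
    unfolding growth_def
    by (intro Limsup_mono eventually_mono[OF eventually_gt_at_top[of 0]])
      (auto intro!: divide_right_mono ln_of_nat_mono)
qed

section \<open>Entropy as a supremum over scales\<close>

text \<open>\<open>Lim\<close> has its intended meaning only if the limit exists; it does because
  \<open>growth\<close> increases as the scale shrinks to 0.\<close>

lemma entropy_on_eq_SUP:
  fixes \<phi> :: "real \<Rightarrow> 'a::metric_space \<Rightarrow> 'a"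
  assumes "compact (UNIV :: 'a set)" "is_flow \<phi>" "compact K"
  shows "entropy_on \<phi> K = (SUP \<epsilon>\<in>{0<..}. growth \<phi> K \<epsilon>)"
proof -
  have "(growth \<phi> K \<longlongrightarrow> (SUP \<epsilon>\<in>{0<..}. growth \<phi> K \<epsilon>)) (at_right 0)"
  proof (rule order_tendstoI)
    fix a assume "a < (SUP \<epsilon>\<in>{0<..}. growth \<phi> K \<epsilon>)"
    then obtain \<epsilon> where \<epsilon>: "\<epsilon> > 0" "a < growth \<phi> K \<epsilon>"
      by (auto simp: less_SUP_iff)
    have "a < growth \<phi> K e" if "e > 0" "e < \<epsilon>" for e
      using growth_antimono[OF assms, of e \<epsilon>] that \<epsilon>(2) by auto
    then show "\<forall>\<^sub>F e in at_right 0. a < growth \<phi> K e"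
      using \<epsilon>(1) unfolding eventually_at_right_field by blast
  next
    fix a assume "(SUP \<epsilon>\<in>{0<..}. growth \<phi> K \<epsilon>) < a"
    then have "growth \<phi> K e < a" if "e > 0" for e
      using that SUP_upper[of e "{0<..}" "growth \<phi> K"] by auto
    then show "\<forall>\<^sub>F e in at_right 0. growth \<phi> K e < a"
      unfolding eventually_at_right_field using zero_less_one by blast
  qed
  then show ?thesis
    unfolding entropy_on_def growth_def by (intro tendsto_Lim) auto
qed

text \<open>A supremum over all positive scales is unaffected by rescaling, so constant losses in
  \<epsilon> are harmless.\<close>

lemma entropy_on_le_if_growth_le:
  fixes \<phi> :: "real \<Rightarrow> 'a::metric_space \<Rightarrow> 'a"
  assumes "compact (UNIV :: 'a set)" "is_flow \<phi>" "compact K" "compact L" "c > 0"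
    and le: "\<And>\<epsilon>. \<epsilon> > 0 \<Longrightarrow> growth \<phi> K (c * \<epsilon>) \<le> growth \<phi> L \<epsilon>"
  shows "entropy_on \<phi> K \<le> entropy_on \<phi> L"
  unfolding entropy_on_eq_SUP[OF assms(1-3)] entropy_on_eq_SUP[OF assms(1,2,4)]
proof (rule SUP_least)
  fix \<epsilon> :: real assume "\<epsilon> \<in> {0<..}"
  then have "growth \<phi> K \<epsilon> \<le> growth \<phi> L (\<epsilon> / c)"
    using le[of "\<epsilon> / c"] \<open>c > 0\<close> by simp
  also have "\<dots> \<le> (SUP \<epsilon>\<in>{0<..}. growth \<phi> L \<epsilon>)"
    using \<open>\<epsilon> \<in> {0<..}\<close> \<open>c > 0\<close> by (intro SUP_upper) simp
  finally show "growth \<phi> K \<epsilon> \<le> (SUP \<epsilon>\<in>{0<..}. growth \<phi> L \<epsilon>)" .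
qed

lemma entropy_on_mono:
  fixes \<phi> :: "real \<Rightarrow> 'a::metric_space \<Rightarrow> 'a"
  assumes "compact (UNIV :: 'a set)" "is_flow \<phi>" "compact K" "compact L" "K \<subseteq> L"
  shows "entropy_on \<phi> K \<le> entropy_on \<phi> L"
proof (rule entropy_on_le_if_growth_le[OF assms(1-4), of 2])
  fix \<epsilon> :: real assume "\<epsilon> > 0"
  have "span_num \<phi> K t (2 * \<epsilon>) \<le> span_num \<phi> L t \<epsilon>" for t
  proof -
    obtain F where F: "spans \<phi> L t \<epsilon> F" "card F = span_num \<phi> L t \<epsilon>"
      using ex_minimal_spanning_set[OF assms(1,2) \<open>\<epsilon> > 0\<close> assms(4)] by metis
    then have "spans \<phi> K t \<epsilon> F"
      using assms(5) by (auto simp: spans_def)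
    then show ?thesis
      using span_num_le_card_external F(2) by metis
  qed
  then show "growth \<phi> K (2 * \<epsilon>) \<le> growth \<phi> L \<epsilon>"
    unfolding growth_def
    by (intro Limsup_mono eventually_mono[OF eventually_gt_at_top[of 0]])
      (auto intro!: divide_right_mono ln_of_nat_mono)
qed simp

text \<open>Rests on \<open>ln 0 = 0\<close>. The empty set is the base case for vanishing entropy
  and gives the lower bound 0 for \<open>entropy_star\<close>.\<close>

lemma entropy_on_empty: "entropy_on \<phi> {} = 0"
proof -
  have "span_num \<phi> {} t \<epsilon> = 0" for t \<epsilon>
    using span_num_le_card[of \<phi> "{}" t \<epsilon> "{}"] by (simp add: spans_def)
  then show ?thesis
    by (simp add: entropy_on_def Limsup_const tendsto_Lim flip: zero_ereal_def)
qed

section \<open>Sets that contribute no exponential growth\<close>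

text \<open>Used to discard the logarithm of a bounded factor after division by
  \<open>t\<close>.\<close>

lemma Limsup_add_tendsto_zero_le:
  fixes f g :: "real \<Rightarrow> real"
  assumes "(g \<longlongrightarrow> 0) at_top"
  shows "Limsup at_top (\<lambda>t. ereal (f t + g t)) \<le> Limsup at_top (\<lambda>t. ereal (f t))"
proof (rule ereal_le_epsilon2)
  fix e :: real assume "e > 0"
  then have "\<forall>\<^sub>F t in at_top. g t < e"
    using assms by (auto dest: order_tendstoD)
  then have "Limsup at_top (\<lambda>t. ereal (f t + g t)) \<le> Limsup at_top (\<lambda>t. ereal (f t) + ereal e)"
    by (intro Limsup_mono) (auto elim!: eventually_mono)
  also have "\<dots> = Limsup at_top (\<lambda>t. ereal (f t)) + ereal e"
    by (intro Limsup_add_ereal_right) auto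
  finally show "Limsup at_top (\<lambda>t. ereal (f t + g t)) \<le> Limsup at_top (\<lambda>t. ereal (f t)) + ereal e" .
qed

text \<open>A set \<open>S\<close> on which the flow is equicontinuous needs only a bounded number of
  dynamical balls, so it does not contribute to the exponential growth rate.\<close>

lemma entropy_on_Un_equicontinuous:
  fixes \<phi> :: "real \<Rightarrow> 'a::metric_space \<Rightarrow> 'a"
  assumes "compact (UNIV :: 'a set)" "is_flow \<phi>" "compact K" "compact S"
    and S: "\<And>\<epsilon>. \<epsilon> > 0 \<Longrightarrow> \<exists>F. \<forall>t. spans \<phi> S t \<epsilon> F"
  shows "entropy_on \<phi> (K \<union> S) \<le> entropy_on \<phi> K"
proof (rule entropy_on_le_if_growth_le[OF assms(1,2) _ assms(3), of _ 2])
  fix \<epsilon> :: real assume "\<epsilon> > 0"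
  obtain E where E: "\<And>t. spans \<phi> S t \<epsilon> E"
    using S[OF \<open>\<epsilon> > 0\<close>] by blast
  have bound: "ln (real (span_num \<phi> (K \<union> S) t (2 * \<epsilon>))) / t
      \<le> ln (real (span_num \<phi> K t \<epsilon>)) / t + ln (real (1 + card E)) / t" if "t > 0" for t
  proof -
    obtain F where F: "spans \<phi> K t \<epsilon> F" "card F = span_num \<phi> K t \<epsilon>"
      using ex_minimal_spanning_set[OF assms(1,2) \<open>\<epsilon> > 0\<close> assms(3)] by metis
    have "spans \<phi> (K \<union> S) t \<epsilon> (F \<union> E)"
      using F(1) E[of t] by (auto simp: spans_def)
    then have "span_num \<phi> (K \<union> S) t (2 * \<epsilon>) \<le> card (F \<union> E)"
      by (rule span_num_le_card_external)
    also have "\<dots> \<le> span_num \<phi> K t \<epsilon> + card E"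
      using card_Un_le[of F E] F(2) by simp
    \<comment> \<open>The sum is turned into a product so that the logarithm splits; the maximum
      with 1 keeps the first factor positive when \<open>K\<close> is empty.\<close>
    also have "\<dots> \<le> max 1 (span_num \<phi> K t \<epsilon>) * (1 + card E)"
      by (cases "span_num \<phi> K t \<epsilon>") auto
    finally have "ln (real (span_num \<phi> (K \<union> S) t (2 * \<epsilon>)))
        \<le> ln (real (max 1 (span_num \<phi> K t \<epsilon>) * (1 + card E)))"
      by (rule ln_of_nat_mono)
    also have "\<dots> = ln (real (max 1 (span_num \<phi> K t \<epsilon>))) + ln (real (1 + card E))"
      by (subst of_nat_mult, subst ln_mult) auto
    \<comment> \<open>The maximum with 1 is invisible to the logarithm, since
      \<open>ln 0 = ln 1 = 0\<close>.\<close>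
    also have "ln (real (max 1 (span_num \<phi> K t \<epsilon>))) = ln (real (span_num \<phi> K t \<epsilon>))"
      by (cases "span_num \<phi> K t \<epsilon>") (auto simp: max_def)
    finally show ?thesis
      using that by (simp add: divide_right_mono flip: add_divide_distrib)
  qed
  have "growth \<phi> (K \<union> S) (2 * \<epsilon>) \<le> Limsup at_top
      (\<lambda>t. ereal (ln (real (span_num \<phi> K t \<epsilon>)) / t + ln (real (1 + card E)) / t))"
    unfolding growth_def
    by (intro Limsup_mono eventually_mono[OF eventually_gt_at_top[of 0]]) (use bound in auto)
  also have "\<dots> \<le> growth \<phi> K \<epsilon>"
    unfolding growth_def by (intro Limsup_add_tendsto_zero_le) real_asymp
  finally show "growth \<phi> (K \<union> S) (2 * \<epsilon>) \<le> growth \<phi> K \<epsilon>" .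
qed (use assms in auto)

section \<open>Singular points, nonwandering points and equicontinuity\<close>

lemma closed_Sing:
  assumes "is_flow \<phi>"
  shows "closed (Sing \<phi>)"
proof -
  have "continuous_on UNIV (\<phi> t)" for t
    using continuous_on_compose2[of UNIV "\<lambda>p. \<phi> (fst p) (snd p)" UNIV "\<lambda>x. (t, x)"] assms
    by (simp add: is_flow_def continuous_intros)
  then have "closed {x. \<phi> t x = x}" for t
    by (intro closed_Collect_eq) (auto intro: continuous_intros)
  then have "closed (\<Inter>t. {x. \<phi> t x = x})" by auto
  also have "(\<Inter>t. {x. \<phi> t x = x}) = Sing \<phi>" by (auto simp: Sing_def)
  finally show ?thesis .
qed

lemma Sing_subset_nonwandering: "Sing \<phi> \<subseteq> nonwandering \<phi>"
proof
  fix x assume x: "x \<in> Sing \<phi>"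
  have "U \<inter> (\<Union>t\<in>{T..}. \<phi> t ` U) \<noteq> {}" if "x \<in> U" for U T
  proof -
    have "x \<in> \<phi> T ` U"
      using x that by (force simp: Sing_def intro: rev_image_eqI)
    then have "x \<in> U \<inter> (\<Union>t\<in>{T..}. \<phi> t ` U)"
      using that by auto
    then show ?thesis by blast
  qed
  then show "x \<in> nonwandering \<phi>"
    by (simp add: nonwandering_def)
qed

text \<open>An open set witnessing that one point wanders does so for each of its points.\<close>

lemma closed_nonwandering: "closed (nonwandering \<phi>)"
proof -
  have "\<exists>U. open U \<and> x \<in> U \<and> U \<subseteq> - nonwandering \<phi>" if "x \<notin> nonwandering \<phi>" for x
    using that unfolding nonwandering_def by blast
  then show ?thesis
    unfolding closed_def by (subst open_subopen) auto
qed

text \<open>Fixed points keep their initial distance forever, so one finite cover by balls serves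
  all times \<open>t\<close>.\<close>

lemma spans_Sing:
  fixes \<phi> :: "real \<Rightarrow> 'a::metric_space \<Rightarrow> 'a"
  assumes "compact (Sing \<phi>)" "\<epsilon> > 0"
  shows "\<exists>F. \<forall>t. spans \<phi> (Sing \<phi>) t \<epsilon> F"
proof -
  obtain F where F: "finite F" "F \<subseteq> Sing \<phi>" "Sing \<phi> \<subseteq> (\<Union>x\<in>F. ball x \<epsilon>)"
    using compactE_image[OF assms(1), of "Sing \<phi>" "\<lambda>x. ball x \<epsilon>"] assms(2) by force
  have "Sing \<phi> \<subseteq> (\<Union>x\<in>F. dyn_ball \<phi> t \<epsilon> x)" for t
  proof
    fix y assume y: "y \<in> Sing \<phi>"
    then obtain x where x: "x \<in> F" "dist x y < \<epsilon>"
      using F(3) by auto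
    then have "y \<in> dyn_ball \<phi> t \<epsilon> x"
      using y F(2) by (auto simp: dyn_ball_def Sing_def)
    then show "y \<in> (\<Union>x\<in>F. dyn_ball \<phi> t \<epsilon> x)"
      using x(1) by (rule UN_I[rotated])
  qed
  then have "spans \<phi> (Sing \<phi>) t \<epsilon> F" for t
    using F(1) by (simp add: spans_def)
  then show ?thesis by blast
qed

text \<open>Off the singularities the admissible distance \<delta> times the distance to
  \<open>Sing \<phi>\<close> is positive, so balls of that radius cover \<open>K\<close>; a finite
  subcover works for every \<open>t\<close>.\<close>

lemma spans_singular_equicontinuous:
  fixes \<phi> :: "real \<Rightarrow> 'a::metric_space \<Rightarrow> 'a"
  assumes "singular_equicontinuous \<phi>" "closed (Sing \<phi>)" "compact K" "K \<subseteq> - Sing \<phi>" "\<epsilon> > 0"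
  shows "\<exists>F. \<forall>t. spans \<phi> K t \<epsilon> F"
proof -
  obtain \<delta> where \<delta>: "\<delta> > 0" and close: "\<And>x y t. ereal (dist x y) \<le> ereal \<delta> * dist_set x (Sing \<phi>)
      \<Longrightarrow> dist (\<phi> t x) (\<phi> t y) \<le> \<epsilon>"
    using assms(1,5) unfolding singular_equicontinuous_def by metis
  \<comment> \<open>If there are no singularities, \<open>dist_set\<close> is infinite and every
    radius is admissible; 1 is an arbitrary choice.\<close>
  define r where "r x = (if Sing \<phi> = {} then 1 else \<delta> * infdist x (Sing \<phi>))" for x
  have r_pos: "r x > 0" if "x \<in> K" for x
    using that \<delta> assms(2,4) infdist_pos_not_in_closed[of "Sing \<phi>" x]
    by (auto simp: r_def intro!: mult_pos_pos)
  have ball_le: "ball x (r x) \<subseteq> dyn_ball \<phi> t \<epsilon> x" for x t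
  proof
    fix y assume "y \<in> ball x (r x)"
    then have "ereal (dist x y) \<le> ereal \<delta> * dist_set x (Sing \<phi>)"
      using \<delta> by (auto simp: r_def dist_set_def split: if_splits)
    then show "y \<in> dyn_ball \<phi> t \<epsilon> x"
      using close by (simp add: dyn_ball_def)
  qed
  have "K \<subseteq> (\<Union>x\<in>K. ball x (r x))"
    using r_pos by auto
  then obtain F where F: "finite F" "K \<subseteq> (\<Union>x\<in>F. ball x (r x))"
    by (rule compactE_image[OF assms(3) open_ball])
  have "K \<subseteq> (\<Union>x\<in>F. dyn_ball \<phi> t \<epsilon> x)" for t
    using F(2) UN_mono[OF order_refl ball_le] by (rule order_trans)
  then have "spans \<phi> K t \<epsilon> F" for t
    using F(1) by (simp add: spans_def)
  then show ?thesis by blast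
qed

section \<open>Coding orbits by good and wandering pieces\<close>

text \<open>Induction on the length, splitting by the first letter: a good one keeps the budget
  \<open>M\<close>, a bad one lowers it by 1. For fixed \<open>M\<close> the bad letters cost only a
  factor polynomial in \<open>k\<close>.\<close>

lemma card_lists_few_bad_letters:
  assumes "finite G" "finite B" "p \<ge> 1" "card G \<le> p"
  shows "finite {xs. length xs = k \<and> set xs \<subseteq> G \<union> B \<and> length (filter (\<lambda>x. x \<in> B) xs) \<le> M}
    \<and> card {xs. length xs = k \<and> set xs \<subseteq> G \<union> B \<and> length (filter (\<lambda>x. x \<in> B) xs) \<le> M}
      \<le> (1 + card B * k) ^ M * p ^ k"
    (is "finite (?A k M) \<and> _")
proof (induction k arbitrary: M)
  case 0
  have "?A 0 M = {[]}" by auto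
  then show ?case by simp
next
  case (Suc k)
  let ?m = "card B"
  let ?good = "(\<lambda>(x, xs). x # xs) ` (G \<times> ?A k M)"
  let ?bad = "\<lambda>N. (\<lambda>(x, xs). x # xs) ` (B \<times> ?A k N)"
  have card_good: "card ?good \<le> p * ((1 + ?m * k) ^ M * p ^ k)"
  proof -
    have "card ?good \<le> card G * card (?A k M)"
      using card_image_le[of "G \<times> ?A k M" "\<lambda>(x, xs). x # xs"] Suc.IH[of M] assms
      by (simp add: card_cartesian_product)
    also have "\<dots> \<le> p * ((1 + ?m * k) ^ M * p ^ k)"
      using Suc.IH[of M] assms by (intro mult_le_mono) auto
    finally show ?thesis .
  qed
  have card_bad: "card (?bad N) \<le> ?m * ((1 + ?m * k) ^ N * p ^ k)" for N
  proof -
    have "card (?bad N) \<le> ?m * card (?A k N)"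
      using card_image_le[of "B \<times> ?A k N" "\<lambda>(x, xs). x # xs"] Suc.IH[of N] assms
      by (simp add: card_cartesian_product)
    also have "\<dots> \<le> ?m * ((1 + ?m * k) ^ N * p ^ k)"
      using Suc.IH[of N] assms by (intro mult_le_mono) auto
    finally show ?thesis .
  qed
  have fin: "finite ?good" "finite (?bad N)" for N
    using Suc.IH assms by auto
  show ?case
  proof (cases M)
    case 0
    have sub: "?A (Suc k) M \<subseteq> ?good"
    proof
      fix xs assume "xs \<in> ?A (Suc k) M"
      then show "xs \<in> ?good"
        using 0 by (cases xs) (auto split: if_splits)
    qed
    show ?thesis
      using card_good 0 finite_subset[OF sub fin(1)] card_mono[OF fin(1) sub] by simp
  next
    case (Suc N)
    have sub: "?A (Suc k) M \<subseteq> ?good \<union> ?bad N"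
    proof
      fix xs assume "xs \<in> ?A (Suc k) M"
      then show "xs \<in> ?good \<union> ?bad N"
        using Suc by (cases xs) (auto split: if_splits)
    qed
    have fin_Un: "finite (?good \<union> ?bad N)"
      using fin by blast
    have "finite (?A (Suc k) M)" "card (?A (Suc k) M) \<le> card (?good \<union> ?bad N)"
      using finite_subset[OF sub fin_Un] card_mono[OF fin_Un sub] .
    moreover have "card (?good \<union> ?bad N) \<le> card ?good + card (?bad N)"
      by (rule card_Un_le)
    moreover have "p * ((1 + ?m * k) ^ M * p ^ k) + ?m * ((1 + ?m * k) ^ N * p ^ k)
        \<le> (1 + ?m * Suc k) ^ M * p ^ Suc k"
    proof -
      \<comment> \<open>The extra factor \<open>p\<close> on the second summand, allowed by
        \<open>p \<ge> 1\<close>, makes \<open>p ^ Suc k\<close> a common factor.\<close>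
      have "p * ((1 + ?m * k) ^ M * p ^ k) + ?m * ((1 + ?m * k) ^ N * p ^ k)
          \<le> p * ((1 + ?m * k) ^ M * p ^ k) + p * (?m * ((1 + ?m * k) ^ N * p ^ k))"
        using assms(3) by simp
      also have "\<dots> = ((1 + ?m * k) ^ N * (1 + ?m * Suc k)) * p ^ Suc k"
        using Suc by (simp add: algebra_simps)
      also have "\<dots> \<le> ((1 + ?m * Suc k) ^ N * (1 + ?m * Suc k)) * p ^ Suc k"
        by (intro mult_le_mono power_mono) auto
      finally show ?thesis
        using Suc by (simp add: mult.commute)
    qed
    ultimately show ?thesis
      using card_good card_bad[of N] by linarith
  qed
qed

lemma ex_time_step:
  fixes s \<tau> :: real
  assumes "0 \<le> s" "s \<le> real k * \<tau>" "k > 0"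
  shows "\<exists>j<k. s - real j * \<tau> \<in> {0..\<tau>}"
  using assms
proof (induction k)
  case (Suc k)
  show ?case
  \<comment> \<open>The conjunct \<open>k > 0\<close> is what the induction hypothesis demands; for
    \<open>k = 0\<close> the only window has index 0.\<close>
  proof (cases "s \<le> real k * \<tau> \<and> k > 0")
    case True
    then show ?thesis
      using Suc.IH Suc.prems(1) less_SucI by blast
  next
    case False
    then have "s - real k * \<tau> \<in> {0..\<tau>}"
      using Suc.prems by (auto simp: algebra_simps)
    then show ?thesis by blast
  qed
qed simp

text \<open>\<open>m\<close> and \<open>M\<close> are fixed before \<open>k\<close> and
  \<open>t\<close>, so the first factor is polynomial in \<open>k\<close>. The radius is
  \<open>4 * \<epsilon>\<close> because an orbit piece is within \<open>2 * \<epsilon>\<close> of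
  its centre, once for the detour through a nonwandering point and once for its centre, and two
  pieces with one centre are compared.\<close>

lemma span_num_UNIV_le:
  fixes \<phi> :: "real \<Rightarrow> 'a::metric_space \<Rightarrow> 'a"
  assumes "compact (UNIV :: 'a set)" "is_flow \<phi>" "\<epsilon> > 0" "\<tau> > 0"
  obtains m M where "\<And>k t. k > 0 \<Longrightarrow> t \<le> real k * \<tau> \<Longrightarrow> span_num \<phi> UNIV t (4 * \<epsilon>)
    \<le> (1 + m * k) ^ M * max 1 (span_num \<phi> (nonwandering \<phi>) \<tau> \<epsilon>) ^ k"
proof -
  let ?\<Omega> = "nonwandering \<phi>"
  have comp_\<Omega>: "compact ?\<Omega>"
    using assms(1) closed_nonwandering[of \<phi>] compact_Int_closed[of UNIV ?\<Omega>] by simp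
  have flow_add: "\<phi> (a + b) x = \<phi> a (\<phi> b x)" for a b x
    using assms(2) by (simp add: is_flow_def)
  obtain \<delta> where \<delta>: "\<delta> > 0" "\<And>x y. dist x y < \<delta> \<Longrightarrow> y \<in> dyn_ball \<phi> \<tau> \<epsilon> x"
    using flow_uniformly_continuous[OF assms(1-3)] by metis
  obtain F where F: "spans \<phi> ?\<Omega> \<tau> \<epsilon> F" "card F = span_num \<phi> ?\<Omega> \<tau> \<epsilon>"
    using ex_minimal_spanning_set[OF assms(1-3) comp_\<Omega>] by metis
  define U where "U = (\<Union>y\<in>?\<Omega>. ball y \<delta>)"
  have "\<exists>V T. open V \<and> w \<in> V \<and> T > 0 \<and> V \<inter> (\<Union>t\<in>{T..}. \<phi> t ` V) = {}"
    if "w \<in> - U" for w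
  proof -
    have "w \<notin> ?\<Omega>" using that \<delta>(1) by (auto simp: U_def)
    then show ?thesis unfolding nonwandering_def by blast
  qed
  then obtain V T where V: "\<And>w. w \<in> - U \<Longrightarrow> open (V w)" "\<And>w. w \<in> - U \<Longrightarrow> w \<in> V w"
    and T: "\<And>w. w \<in> - U \<Longrightarrow> T w > (0::real)"
    and wander: "\<And>w. w \<in> - U \<Longrightarrow> V w \<inter> (\<Union>t\<in>{T w..}. \<phi> t ` V w) = {}"
    by metis
  have "open U"
    by (auto simp: U_def)
  then have "compact (- U)"
    using assms(1) compact_Int_closed[of UNIV "- U"] by (simp add: closed_Compl)
  \<comment> \<open>Intersecting with \<open>ball w \<delta>\<close> makes a wandering set also
    control the orbit piece that starts in it.\<close>
  then obtain W where W: "W \<subseteq> - U" "finite W" "- U \<subseteq> (\<Union>w\<in>W. V w \<inter> ball w \<delta>)"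
    by (rule compactE_image[of "- U" "- U" "\<lambda>w. V w \<inter> ball w \<delta>"]) (use V \<delta>(1) in auto)
  \<comment> \<open>The sum type separates good letters from wandering ones even where
    \<open>F\<close> and \<open>W\<close> overlap.\<close>
  define admissible where "admissible z l \<longleftrightarrow> (case l of
      Inl x \<Rightarrow> x \<in> F \<and> z \<in> dyn_ball \<phi> \<tau> (2 * \<epsilon>) x
    | Inr w \<Rightarrow> w \<in> W \<and> z \<in> V w \<and> z \<in> dyn_ball \<phi> \<tau> (2 * \<epsilon>) w)" for z :: 'a and l :: "'a + 'a"
  have "\<exists>l. admissible z l" for z
  proof (cases "z \<in> U")
    case True
    then obtain y where y: "y \<in> ?\<Omega>" "dist y z < \<delta>"
      by (auto simp: U_def)
    then obtain x where x: "x \<in> F" "y \<in> dyn_ball \<phi> \<tau> \<epsilon> x"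
      using F(1) by (auto simp: spans_def)
    have "z \<in> dyn_ball \<phi> \<tau> \<epsilon> y" "x \<in> dyn_ball \<phi> \<tau> \<epsilon> y"
      using \<delta>(2)[OF y(2)] x(2) by (auto simp: dyn_ball_def dist_commute)
    then have "z \<in> dyn_ball \<phi> \<tau> (2 * \<epsilon>) x"
      by (intro dyn_ball_common_center)
    then have "admissible z (Inl x)"
      using x(1) by (simp add: admissible_def)
    then show ?thesis by blast
  next
    case False
    then obtain w where w: "w \<in> W" "z \<in> V w" "dist w z < \<delta>"
      using W(3) by auto
    have "z \<in> dyn_ball \<phi> \<tau> (2 * \<epsilon>) w"
      using \<delta>(2)[OF w(3)] dyn_ball_mono[of \<tau> \<tau> \<epsilon> "2 * \<epsilon>"] assms(3) by auto
    then have "admissible z (Inr w)"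
      using w by (simp add: admissible_def)
    then show ?thesis by blast
  qed
  then obtain letter where letter: "\<And>z. admissible z (letter z)"
    by metis
  have letter_close: "z' \<in> dyn_ball \<phi> \<tau> (4 * \<epsilon>) z" if "letter z = letter z'" for z z'
  proof -
    have "\<exists>x. z \<in> dyn_ball \<phi> \<tau> (2 * \<epsilon>) x \<and> z' \<in> dyn_ball \<phi> \<tau> (2 * \<epsilon>) x"
      using letter[of z] letter[of z'] that
      by (cases "letter z'") (auto simp: admissible_def)
    then show ?thesis
      using dyn_ball_common_center[of z \<phi> \<tau> "2 * \<epsilon>"] by auto
  qed
  \<comment> \<open>\<open>c\<close> steps exceed every waiting time \<open>T w\<close>; the sum
    serves as a common upper bound, also when \<open>W\<close> is empty.\<close>
  obtain c :: nat where c: "(\<Sum>w\<in>W. T w) < real c * \<tau>"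
    using reals_Archimedean3[OF assms(4)] by blast
  have T_le: "T w < real c * \<tau>" if "w \<in> W" for w
    using member_le_sum[of w W T] that W(1,2) T c by (force intro: less_imp_le)
  define code where "code k z = map (\<lambda>j. letter (\<phi> (real j * \<tau>) z)) [0..<k]" for k z
  have few_visits: "card {j. j < k \<and> letter (\<phi> (real j * \<tau>) z) = Inr w} \<le> c"
    (is "card ?J \<le> c") if "w \<in> W" for k z w
  proof (cases "?J = {}")
    case True
    then show ?thesis by (simp only: card.empty)
  next
    case False
    \<comment> \<open>Two visits to \<open>V w\<close> at least \<open>c\<close> steps apart would
      be a return after time \<open>T w\<close>, which \<open>wander\<close> excludes. Hence all
      visits fit into \<open>c\<close> consecutive indices from the first one on.\<close>
    have gap: "i < j + c" if "i \<in> ?J" "j \<in> ?J" for i j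
    proof (rule ccontr)
      assume "\<not> i < j + c"
      then have "real c \<le> real i - real j" by linarith
      then have "real c * \<tau> \<le> real i * \<tau> - real j * \<tau>"
        using assms(4) by (simp flip: left_diff_distrib)
      then have late: "real i * \<tau> - real j * \<tau> \<in> {T w..}"
        using T_le[OF \<open>w \<in> W\<close>] by simp
      have in_V: "\<phi> (real i * \<tau>) z \<in> V w" "\<phi> (real j * \<tau>) z \<in> V w"
        using that letter[of "\<phi> (real i * \<tau>) z"] letter[of "\<phi> (real j * \<tau>) z"]
        by (auto simp: admissible_def)
      have "\<phi> (real i * \<tau>) z = \<phi> (real i * \<tau> - real j * \<tau>) (\<phi> (real j * \<tau>) z)"
        by (simp flip: flow_add)
      then have "\<phi> (real i * \<tau>) z \<in> V w \<inter> (\<Union>t\<in>{T w..}. \<phi> t ` V w)"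
        using in_V late by blast
      then show False
        using wander W(1) \<open>w \<in> W\<close> by blast
    qed
    have "Min ?J \<in> ?J"
      using False by (intro Min_in) auto
    then have "?J \<subseteq> {Min ?J..<Min ?J + c}"
      using gap by (auto intro: Min_le)
    then have "card ?J \<le> card {Min ?J..<Min ?J + c}"
      by (intro card_mono) auto
    then show ?thesis by simp
  qed
  have few_bad: "length (filter (\<lambda>l. l \<in> Inr ` W) (code k z)) \<le> card W * c" for k z
  proof -
    have "length (filter (\<lambda>l. l \<in> Inr ` W) (code k z))
        = card (\<Union>w\<in>W. {j. j < k \<and> letter (\<phi> (real j * \<tau>) z) = Inr w})"
      unfolding length_filter_conv_card code_def
      by (intro arg_cong[where f = card]) auto
    also have "\<dots> \<le> (\<Sum>w\<in>W. card {j. j < k \<and> letter (\<phi> (real j * \<tau>) z) = Inr w})"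
      using W(2) by (rule card_UN_le)
    also have "\<dots> \<le> card W * c"
      using sum_bounded_above[of W _ c] few_visits by simp
    finally show ?thesis .
  qed
  show thesis
  proof (rule that[of "card W" "card W * c"])
    fix k :: nat and t :: real
    assume k: "k > 0" and t: "t \<le> real k * \<tau>"
    \<comment> \<open>The counting lemma requires \<open>p \<ge> 1\<close>, which the spanning
      number violates if there are no nonwandering points.\<close>
    let ?p = "max 1 (span_num \<phi> ?\<Omega> \<tau> \<epsilon>)"
    let ?S = "{xs. length xs = k \<and> set xs \<subseteq> Inl ` F \<union> Inr ` W
      \<and> length (filter (\<lambda>l. l \<in> Inr ` W) xs) \<le> card W * c}"
    have card_W: "card (Inr ` W) = card W" and card_F: "card (Inl ` F) \<le> ?p"
      using F(2) by (auto simp: card_image)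
    have S: "finite ?S" "card ?S \<le> (1 + card W * k) ^ (card W * c) * ?p ^ k"
      using card_lists_few_bad_letters[of "Inl ` F" "Inr ` W" ?p k "card W * c"]
        F(1) W(2) card_F by (auto simp: spans_def card_W)
    have range_code: "code k ` UNIV \<subseteq> ?S"
    proof -
      have "letter z \<in> Inl ` F \<union> Inr ` W" for z
        using letter[of z] by (cases "letter z") (auto simp: admissible_def)
      then have "length (code k z) = k \<and> set (code k z) \<subseteq> Inl ` F \<union> Inr ` W" for z
        unfolding code_def by fastforce
      then show ?thesis
        using few_bad by blast
    qed
    have "y \<in> dyn_ball \<phi> t (4 * \<epsilon>) x" if eq: "code k x = code k y" for x y
    proof -
      have "dist (\<phi> s x) (\<phi> s y) \<le> 4 * \<epsilon>" if s: "s \<in> {0..t}" for s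
      proof -
        \<comment> \<open>At time \<open>s\<close> both orbits are in their \<open>j\<close>-th
          piece, where they carry the same letter.\<close>
        obtain j where j: "j < k" "s - real j * \<tau> \<in> {0..\<tau>}"
          using ex_time_step[of s k \<tau>] s k t by auto
        have "letter (\<phi> (real j * \<tau>) x) = letter (\<phi> (real j * \<tau>) y)"
          using eq j(1) by (simp add: code_def)
        then have "dist (\<phi> (s - real j * \<tau>) (\<phi> (real j * \<tau>) x))
            (\<phi> (s - real j * \<tau>) (\<phi> (real j * \<tau>) y)) \<le> 4 * \<epsilon>"
          using letter_close j(2) unfolding dyn_ball_def by blast
        then show ?thesis
          by (simp flip: flow_add)
      qed
      then show ?thesis by (simp add: dyn_ball_def)
    qed
    then have "span_num \<phi> UNIV t (4 * \<epsilon>) \<le> card ?S"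
      by (intro span_num_le_card_code[OF S(1) range_code])
    also note S(2)
    finally show "span_num \<phi> UNIV t (4 * \<epsilon>) \<le> (1 + card W * k) ^ (card W * c) * ?p ^ k" .
  qed
qed

text \<open>With about \<open>t / \<tau>\<close> pieces, the polynomial factor vanishes under
  logarithm and division by \<open>t\<close>, leaving the rate per piece. Each single \<tau> thus
  gives a bound.\<close>

lemma growth_UNIV_le:
  fixes \<phi> :: "real \<Rightarrow> 'a::metric_space \<Rightarrow> 'a"
  assumes "compact (UNIV :: 'a set)" "is_flow \<phi>" "\<epsilon> > 0" "\<tau> > 0"
  shows "growth \<phi> UNIV (4 * \<epsilon>) \<le> ereal (ln (real (span_num \<phi> (nonwandering \<phi>) \<tau> \<epsilon>)) / \<tau>)"
proof -
  define p where "p = max 1 (span_num \<phi> (nonwandering \<phi>) \<tau> \<epsilon>)"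
  obtain m M where bound: "\<And>k t. k > 0 \<Longrightarrow> t \<le> real k * \<tau> \<Longrightarrow>
      span_num \<phi> UNIV t (4 * \<epsilon>) \<le> (1 + m * k) ^ M * p ^ k"
    using span_num_UNIV_le[OF assms] unfolding p_def by metis
  have p: "p \<ge> 1" by (simp add: p_def)
  \<comment> \<open>Adding 1 makes the coefficient positive even for \<open>m = 0\<close>, which the
    asymptotic evaluation of \<open>g\<close> uses.\<close>
  define a where "a = real m + 1"
  have "a > 0" by (simp add: a_def)
  define g where "g t = (real M * ln (1 + a * (t / \<tau> + 1)) + (t / \<tau> + 1) * ln (real p)) / t" for t
  have le_g: "ln (real (span_num \<phi> UNIV t (4 * \<epsilon>))) / t \<le> g t" if "t > 0" for t
  proof -
    \<comment> \<open>The least number of pieces of length \<tau> that cover the time interval up to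
      \<open>t\<close>.\<close>
    define k where "k = nat \<lceil>t / \<tau>\<rceil>"
    have "0 < t / \<tau>" using that assms(4) by simp
    then have k: "k > 0" "t / \<tau> \<le> real k" "real k \<le> t / \<tau> + 1"
      unfolding k_def by linarith+
    then have "t \<le> real k * \<tau>"
      using assms(4) by (simp add: field_simps)
    then have "ln (real (span_num \<phi> UNIV t (4 * \<epsilon>))) \<le> ln (real ((1 + m * k) ^ M * p ^ k))"
      by (intro ln_of_nat_mono bound k(1))
    also have "\<dots> = real M * ln (1 + real m * real k) + real k * ln (real p)"
      using p by (simp add: ln_mult ln_realpow add_nonneg_eq_0_iff)
    also have "\<dots> \<le> real M * ln (1 + a * (t / \<tau> + 1)) + (t / \<tau> + 1) * ln (real p)"
      using k p by (intro add_mono mult_left_mono mult_right_mono ln_mono mult_mono)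
        (auto simp: a_def add_pos_nonneg)
    finally show ?thesis
      using that by (simp add: g_def divide_right_mono)
  qed
  have "(g \<longlongrightarrow> inverse \<tau> * ln (real p)) at_top"
    unfolding g_def using \<open>a > 0\<close> assms(4) by real_asymp
  then have "Limsup at_top (\<lambda>t. ereal (g t)) = ereal (ln (real p) / \<tau>)"
    by (intro lim_imp_Limsup) (auto simp: field_simps)
  moreover have "growth \<phi> UNIV (4 * \<epsilon>) \<le> Limsup at_top (\<lambda>t. ereal (g t))"
    unfolding growth_def
    by (intro Limsup_mono eventually_mono[OF eventually_gt_at_top[of 0]]) (use le_g in auto)
  moreover have "ln (real p) = ln (real (span_num \<phi> (nonwandering \<phi>) \<tau> \<epsilon>))"
    unfolding p_def by (cases "span_num \<phi> (nonwandering \<phi>) \<tau> \<epsilon>") (auto simp: max_def)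
  ultimately show ?thesis by simp
qed

lemma entropy_le_entropy_on_nonwandering:
  fixes \<phi> :: "real \<Rightarrow> 'a::metric_space \<Rightarrow> 'a"
  assumes "compact (UNIV :: 'a set)" "is_flow \<phi>"
  shows "entropy \<phi> \<le> entropy_on \<phi> (nonwandering \<phi>)"
  unfolding entropy_def
proof (rule entropy_on_le_if_growth_le[OF assms assms(1), of _ 4])
  show "compact (nonwandering \<phi>)"
    using assms(1) closed_nonwandering[of \<phi>] compact_Int_closed[of UNIV "nonwandering \<phi>"] by simp
  fix \<epsilon> :: real assume "\<epsilon> > 0"
  show "growth \<phi> UNIV (4 * \<epsilon>) \<le> growth \<phi> (nonwandering \<phi>) \<epsilon>"
    \<comment> \<open>Only the right side is unfolded: the left side is a constant lying below the
      quotient for every positive time \<tau>, hence below its upper limit.\<close>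
    unfolding growth_def[of \<phi> "nonwandering \<phi>"]
    by (intro le_Limsup eventually_mono[OF eventually_gt_at_top[of 0]]
        growth_UNIV_le[OF assms \<open>\<epsilon> > 0\<close>]) auto
qed simp

theorem mainTheorem11:
  fixes \<phi> :: "real \<Rightarrow> 'a::metric_space \<Rightarrow> 'a"
  assumes "compact (UNIV :: 'a set)"
    and "is_flow \<phi>"
  shows "(closed (nonwandering \<phi> - Sing \<phi>) \<longrightarrow> entropy_star \<phi> = entropy \<phi>)
       \<and> (singular_equicontinuous \<phi> \<longrightarrow> entropy_star \<phi> = 0)"
proof (intro conjI impI)
  have comp_Sing: "compact (Sing \<phi>)"
    using closed_Sing[OF assms(2)] assms(1) compact_Int_closed[of UNIV "Sing \<phi>"] by simp
  {
    assume "closed (nonwandering \<phi> - Sing \<phi>)"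
    then have comp: "compact (nonwandering \<phi> - Sing \<phi>)"
      using assms(1) compact_Int_closed[of UNIV "nonwandering \<phi> - Sing \<phi>"] by simp
    have "entropy \<phi> \<le> entropy_on \<phi> (nonwandering \<phi>)"
      using assms by (rule entropy_le_entropy_on_nonwandering)
    also have "nonwandering \<phi> = (nonwandering \<phi> - Sing \<phi>) \<union> Sing \<phi>"
      using Sing_subset_nonwandering by blast
    \<comment> \<open>By the closedness assumption the remaining set is compact and misses the
      singularities, so it competes in the supremum \<open>entropy_star\<close>.\<close>
    also have "entropy_on \<phi> \<dots> \<le> entropy_on \<phi> (nonwandering \<phi> - Sing \<phi>)"
      using spans_Sing comp_Sing
      by (intro entropy_on_Un_equicontinuous assms comp) auto
    also have "\<dots> \<le> entropy_star \<phi>"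
      unfolding entropy_star_def using comp by (intro SUP_upper) auto
    finally have "entropy \<phi> \<le> entropy_star \<phi>" .
    moreover have "entropy_star \<phi> \<le> entropy \<phi>"
      unfolding entropy_star_def entropy_def
      by (intro SUP_least entropy_on_mono assms) auto
    ultimately show "entropy_star \<phi> = entropy \<phi>" by simp
  next
    assume equi: "singular_equicontinuous \<phi>"
    \<comment> \<open>\<open>K\<close> is adjoined as an equicontinuous set to the empty set, whose
      entropy is 0.\<close>
    have "entropy_on \<phi> K \<le> 0" if "compact K" "K \<subseteq> - Sing \<phi>" for K
      using entropy_on_Un_equicontinuous[OF assms compact_empty that(1)]
        spans_singular_equicontinuous[OF equi closed_Sing[OF assms(2)] that]
      by (simp add: entropy_on_empty)
    then have "entropy_star \<phi> \<le> 0"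
      unfolding entropy_star_def by (intro SUP_least) auto
    \<comment> \<open>The empty set is an admissible compact set, which bounds the supremum below by
      0.\<close>
    moreover have "entropy_on \<phi> {} \<le> entropy_star \<phi>"
      unfolding entropy_star_def by (intro SUP_upper) auto
    ultimately show "entropy_star \<phi> = 0"
      by (simp add: entropy_on_empty)
  }
qed

end
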